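(* The DPText mechanism fails to guarantee differential privacy. Precisely: fix either the replacement convention or the rejection convention (defined in the context) for the noise sampler. Then for every privacy budget $\varepsilon > 0$ there exist a dataset universe $\mathcal{X}$, an integer $d \geq 1$ and a numeric query $f : \mathcal{X} \to \mathbb{R}^d$ with $\ell_1$ sensitivity $0 < \Delta < \infty$ such that the DPText mechanism $\mathcal{M}(\,\cdot\,; f)$ with noise scale $b = \Delta/\varepsilon$ is not $(\varepsilon, 0)$-differentially private.
   Context: Datasets. There is a finite set of individuals; a dataset is a subset of this set, and the universe $\mathcal{X}$ is the collection of all such subsets. Two datasets $X, X' \in \mathcal{X}$ are neighboring if they differ in one person, meaning that one is obtained from the other by adding or removing one individual or by replacing one individual by another (e.g. $\{\text{Alice}\}$ and $\{\text{Bob}\}$ are neighboring, and $\{\text{Alice},\text{Bob}\}$ and $\{\text{Bob}\}$ are neighboring). A numeric query is any function $f : \mathcal{X} \to \mathbb{R}^d$. Its $\ell_1$ sensitivity is $\Delta = \max \|f(X) - f(X')\|_1$, the maximum being over all neighboring $X, X' \in \mathcal{X}$. Differential privacy. A randomized mechanism $\mathcal{M}$ taking a dataset $X \in \mathcal{X}$ to a random element of $\mathbb{R}^d$ is $(\varepsilon,0)$-differentially private if for all neighboring $X, X' \in \mathcal{X}$ and all measurable $S \subseteq \mathbb{R}^d$, $\Pr(\mathcal{M}(X) \in S) \leq \exp(\varepsilon)\,\Pr(\mathcal{M}(X') \in S)$. DPText noise sampler with scale $b > 0$. Draw $v \sim \mathrm{Uni}(0,1)$ and transform it through $G(v) = -b\,\mathrm{sgn}(v)\,\ln(1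 - 2|v|)$, where $\ln$ is the real natural logarithm, so that $G(v)$ is defined for $v \in (0,1/2)$ and undefined for $v \in [1/2, 1)$. Undefined values are handled by one of two conventions: (i) Replacement convention: output $G(v)$ if $v < 1/2$, and $0$ if $v \geq 1/2$. (ii) Rejection convention: draw independent $v \sim \mathrm{Uni}(0,1)$ repeatedly, discarding draws with $v \geq 1/2$, and output $G(v)$ for the first draw with $v < 1/2$; that is, the output is distributed as $G(v)$ conditioned on $v < 1/2$. DPText mechanism. Given a numeric query $f : \mathcal{X} \to \mathbb{R}^d$ and a scale $b>0$, $\mathcal{M}(X; f)$ outputs the vector $\tilde{z} \in \mathbb{R}^d$ with $\tilde{z}_i = f(X)_i + s_i$ for $i = 1, \dots, d$, where $s_1, \dots, s_d$ are independent outputs of the DPText noise sampler with scale $b$. *)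

theory Defs
  imports "HOL-Probability.Probability"
begin

inductive neighboring :: "'a set \<Rightarrow> 'a set \<Rightarrow> bool" where
  add: "a \<notin> X \<Longrightarrow> neighboring X (insert a X)"
| remove: "a \<in> X \<Longrightarrow> neighboring X (X - {a})"
| replace: "a \<in> X \<Longrightarrow> b \<notin> X \<Longrightarrow> neighboring X (insert b (X - {a}))"

text \<open>
  For a set \<open>I\<close> of individuals the universe of datasets is \<open>Pow I\<close>. As the dimension \<open>d\<close> is
  existentially quantified in the theorem, a vector of dimension \<open>d\<close> is an element of
  \<open>{..<d} \<rightarrow>\<^sub>E UNIV\<close>, and the Borel space of dimension \<open>d\<close> is the product of \<open>d\<close> copies of the
  real Borel space.
\<close>

abbreviation vec_space :: "nat \<Rightarrow> (nat \<Rightarrow> real) measure" where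
  "vec_space d \<equiv> PiM {..<d} (\<lambda>_. borel)"

definition numeric_query :: "'a set \<Rightarrow> nat \<Rightarrow> ('a set \<Rightarrow> nat \<Rightarrow> real) \<Rightarrow> bool" where
  "numeric_query I d f \<longleftrightarrow> f \<in> Pow I \<rightarrow> ({..<d} \<rightarrow>\<^sub>E UNIV)"

definition l1_dist :: "nat \<Rightarrow> (nat \<Rightarrow> real) \<Rightarrow> (nat \<Rightarrow> real) \<Rightarrow> real" where
  "l1_dist d x y = (\<Sum>i<d. \<bar>x i - y i\<bar>)"

text \<open>
  For finite \<open>I\<close> the maximum below ranges over a finite set, so the sensitivity is a real number
  and in particular finite. The set is empty only if \<open>I = {}\<close>; the value is then unspecified.
\<close>

definition l1_sensitivity :: "'a set \<Rightarrow> nat \<Rightarrow> ('a set \<Rightarrow> nat \<Rightarrow> real) \<Rightarrow> real" where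
  "l1_sensitivity I d f =
     Max {l1_dist d (f X) (f X') | X X'. X \<in> Pow I \<and> X' \<in> Pow I \<and> neighboring X X'}"

text \<open>A mechanism maps a dataset to the distribution of its output.\<close>

definition pure_differentially_private ::
    "'a set \<Rightarrow> nat \<Rightarrow> real \<Rightarrow> ('a set \<Rightarrow> (nat \<Rightarrow> real) measure) \<Rightarrow> bool" where
  "pure_differentially_private I d \<epsilon> M \<longleftrightarrow>
     (\<forall>X\<in>Pow I. \<forall>X'\<in>Pow I. neighboring X X' \<longrightarrow>
       (\<forall>S\<in>sets (vec_space d). measure (M X) S \<le> exp \<epsilon> * measure (M X') S))"

definition unif01 :: "real measure" where
  "unif01 = uniform_measure lborel {0<..<1}"

text \<open>Meaningful on \<open>{0<..<1/2}\<close> only; \<^term>\<open>ln\<close> is total in HOL.\<close>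

definition dptext_G :: "real \<Rightarrow> real \<Rightarrow> real" where
  "dptext_G b v = - b * sgn v * ln (1 - 2 * \<bar>v\<bar>)"

datatype convention = Replacement | Rejection

text \<open>
  Rejection sampling is expressed by its output law, \<open>dptext_G b v\<close> conditioned on \<open>v < 1/2\<close>; the lemma
  \<open>rejection_process_law\<close> below identifies it with the law of the repeated-draw procedure.
\<close>

fun dptext_noise :: "convention \<Rightarrow> real \<Rightarrow> real measure" where
  "dptext_noise Replacement b = distr unif01 borel (\<lambda>v. if v < 1/2 then dptext_G b v else 0)"
| "dptext_noise Rejection b = distr (uniform_measure unif01 {v. v < 1/2}) borel (dptext_G b)"

definition dptext_mechanism ::
    "convention \<Rightarrow> real \<Rightarrow> nat \<Rightarrow> ('a set \<Rightarrow> nat \<Rightarrow> real) \<Rightarrow> 'a set \<Rightarrow> (nat \<Rightarrow> real) measure" where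
  "dptext_mechanism c b d f X =
     distr (PiM {..<d} (\<lambda>_. dptext_noise c b)) (vec_space d) (\<lambda>s. \<lambda>i\<in>{..<d}. f X i + s i)"

lemma prob_space_unif01: "prob_space unif01"
  unfolding unif01_def by (rule prob_space_uniform_measure) auto

lemma sets_unif01 [simp, measurable_cong]: "sets unif01 = sets borel"
  by (simp add: unif01_def)

lemma space_unif01 [simp]: "space unif01 = UNIV"
  by (simp add: unif01_def)

lemma emeasure_unif01_less_half: "emeasure unif01 {v. v < 1/2} = ennreal (1/2)"
proof -
  have "{0<..<1} \<inter> {v. v < 1/2} = {0<..<1/2::real}" by auto
  then show ?thesis unfolding unif01_def by (simp add: emeasure_uniform_measure divide_ennreal_def)
qed

lemma measurable_dptext_G [measurable]: "dptext_G b \<in> borel_measurable borel"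
  unfolding dptext_G_def by measurable

lemma prob_space_dptext_noise: "prob_space (dptext_noise c b)"
proof (cases c)
  case Replacement
  then show ?thesis
    by (auto intro!: prob_space.prob_space_distr prob_space_unif01)
next
  case Rejection
  have "prob_space (uniform_measure unif01 {v. v < 1/2})"
    by (rule prob_space_uniform_measure; subst emeasure_unif01_less_half) simp_all
  then show ?thesis
    using Rejection by (auto intro!: prob_space.prob_space_distr)
qed

lemma sets_dptext_noise [simp, measurable_cong]: "sets (dptext_noise c b) = sets borel"
  by (cases c) auto

lemma sets_dptext_mechanism: "sets (dptext_mechanism c b d f X) = sets (vec_space d)"
  by (simp add: dptext_mechanism_def)

lemma prob_space_dptext_mechanism: "prob_space (dptext_mechanism c b d f X)"
proof -
  interpret product_prob_space "\<lambda>_. dptext_noise c b" "{..<d}"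
    by (intro product_prob_spaceI prob_space_dptext_noise)
  show ?thesis
    unfolding dptext_mechanism_def by (rule prob_space_distr) measurable
qed

lemma finite_l1_dists:
  assumes "finite I"
  shows "finite {l1_dist d (f X) (f X') | X X'. X \<in> Pow I \<and> X' \<in> Pow I \<and> neighboring X X'}"
proof (rule finite_subset)
  show "{l1_dist d (f X) (f X') | X X'. X \<in> Pow I \<and> X' \<in> Pow I \<and> neighboring X X'}
    \<subseteq> (\<lambda>(X, X'). l1_dist d (f X) (f X')) ` (Pow I \<times> Pow I)" by auto
qed (use assms in simp)

text \<open>
  The repeated-draw procedure: \<open>\<omega>\<close> is the sequence of draws, and the output is computed from the
  first draw below \<open>1/2\<close> (which exists almost surely).
\<close>

lemma rejection_process_law:
  "distr (PiM UNIV (\<lambda>_::nat. unif01)) borel (\<lambda>\<omega>. dptext_G b (\<omega> (LEAST n. \<omega> n < 1/2))) =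
   dptext_noise Rejection b"
proof -
  interpret U: prob_space unif01 by (rule prob_space_unif01)
  interpret sequence_space unif01 by unfold_locales
  let ?first = "\<lambda>\<omega>::nat \<Rightarrow> real. \<omega> (LEAST n. \<omega> n < 1/2)"
  have half: "emeasure unif01 {v. \<not> v < 1/2} = ennreal (1/2)"
  proof -
    have "{0<..<1} \<inter> {v. \<not> v < 1/2} = {1/2..<1::real}" by auto
    then show ?thesis
      unfolding unif01_def by (simp add: emeasure_uniform_measure divide_ennreal_def)
  qed
  have split: "(\<integral>\<^sup>+v. indicator ({v. v < 1/2} \<inter> A) v + k * indicator {v. \<not> v < 1/2} v \<partial>unif01) =
      emeasure unif01 ({v. v < 1/2} \<inter> A) + k * ennreal (1/2)"
  if [measurable]: "A \<in> sets borel" for k A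
  proof -
    have "(\<integral>\<^sup>+v. k * indicator {v. \<not> v < 1/2} v \<partial>unif01) = k * ennreal (1/2)"
      unfolding half[symmetric] by (rule nn_integral_cmult_indicator) measurable
    moreover have "(\<integral>\<^sup>+v. indicator ({v. v < 1/2} \<inter> A) v \<partial>unif01) = emeasure unif01 ({v. v < 1/2} \<inter> A)"
      by (rule nn_integral_indicator) measurable
    moreover have "(\<integral>\<^sup>+v. indicator ({v. v < 1/2} \<inter> A) v + k * indicator {v. \<not> v < 1/2} v \<partial>unif01) =
        (\<integral>\<^sup>+v. indicator ({v. v < 1/2} \<inter> A) v \<partial>unif01) + (\<integral>\<^sup>+v. k * indicator {v. \<not> v < 1/2} v \<partial>unif01)"
      by (rule nn_integral_add) measurable
    ultimately show ?thesis
      by (simp only:)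
  qed
  have [measurable]: "(\<lambda>\<omega>. \<omega> n) \<in> borel_measurable S" for n
    using measurable_component_singleton[of n UNIV "\<lambda>_. unif01"] by (simp cong: measurable_cong_sets)
  have first [measurable]: "?first \<in> borel_measurable S"
    by (rule measurable_compose_countable) measurable
  have step: "emeasure S {\<omega>\<in>space S. P \<omega>} =
      (\<integral>\<^sup>+v. emeasure S {\<omega>\<in>space S. P (case_nat v \<omega>)} \<partial>unif01)"
    if [measurable]: "Measurable.pred S P" for P
  proof -
    have sets_Collect_P: "{\<omega>\<in>space S. P \<omega>} \<in> sets S"
      by measurable
    have measurable_sets_pair:
      "{x \<in> space (unif01 \<Otimes>\<^sub>M S). P (case_nat (fst x) (snd x))} \<in> sets (unif01 \<Otimes>\<^sub>M S)"
      by measurable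
    have "emeasure S {\<omega>\<in>space S. P \<omega>} =
        emeasure (distr (unif01 \<Otimes>\<^sub>M S) S (\<lambda>(s, \<omega>). case_nat s \<omega>)) {\<omega>\<in>space S. P \<omega>}"
      by (simp only: PiM_iter)
    also have "\<dots> = emeasure (unif01 \<Otimes>\<^sub>M S)
        {x \<in> space (unif01 \<Otimes>\<^sub>M S). P (case_nat (fst x) (snd x))}"
      using sets_Collect_P
      by (subst emeasure_distr)
        (auto simp: space_pair_measure space_PiM split_beta' intro!: arg_cong2[where f=emeasure])
    also have "\<dots> = (\<integral>\<^sup>+v. emeasure S {\<omega>\<in>space S. P (case_nat v \<omega>)} \<partial>unif01)"
      using measurable_sets_pair
      by (subst P.emeasure_pair_measure_alt)
        (auto simp: space_pair_measure space_PiM intro!: nn_integral_cong arg_cong2[where f=emeasure])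
    finally show ?thesis .
  qed
  have "emeasure S {\<omega>\<in>space S. \<forall>n. \<not> \<omega> n < 1/2} = 0" (is "emeasure S ?N = 0")
  proof -
    have "emeasure S ?N =
      (\<integral>\<^sup>+v. emeasure S {\<omega>\<in>space S. \<forall>n. \<not> case_nat v \<omega> n < 1/2} \<partial>unif01)"
      by (rule step) measurable
    also have "\<dots> = (\<integral>\<^sup>+v. emeasure S ?N * indicator {v. \<not> v < 1/2} v \<partial>unif01)"
    proof (rule nn_integral_cong)
      fix v :: real
      have "(\<forall>n. \<not> case_nat v \<omega> n < 1/2) \<longleftrightarrow> \<not> v < 1/2 \<and> (\<forall>n. \<not> \<omega> n < 1/2)" for \<omega>
        by (metis nat.exhaust old.nat.simps(4) old.nat.simps(5))
      then show "emeasure S {\<omega>\<in>space S. \<forall>n. \<not> case_nat v \<omega> n < 1/2} =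
          emeasure S ?N * indicator {v. \<not> v < 1/2} v"
        by (simp add: indicator_def)
    qed
    also have "\<dots> = emeasure S ?N * ennreal (1/2)"
      by (subst nn_integral_cmult_indicator, simp, subst half, simp)
    finally have "ennreal (measure S ?N) = ennreal (measure S ?N * (1/2))"
      unfolding P.emeasure_eq_measure
      by (subst ennreal_mult) (auto simp only: measure_nonneg)
    then have "measure S ?N = measure S ?N * (1/2)"
      by (subst (asm) ennreal_inj) auto
    then show ?thesis
      by (simp add: P.emeasure_eq_measure)
  qed
  then have "AE \<omega> in S. \<not> (\<forall>n. \<not> \<omega> n < 1/2)"
    by (subst AE_iff_measurable[OF _ refl]) (auto)
  then have ex: "AE \<omega> in S. \<exists>n. \<omega> n < 1/2" by simp
  have "distr S borel ?first = uniform_measure unif01 {v. v < 1/2}"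
  proof (rule measure_eqI)
    fix A assume "A \<in> sets (distr S borel ?first)"
    then have A [measurable]: "A \<in> sets borel" by simp
    let ?p = "emeasure S {\<omega>\<in>space S. ?first \<omega> \<in> A}"
    let ?q = "emeasure unif01 ({v. v < 1/2} \<inter> A)"
    have "?p = (\<integral>\<^sup>+v. emeasure S {\<omega>\<in>space S. ?first (case_nat v \<omega>) \<in> A} \<partial>unif01)"
      by (rule step) measurable
    also have "\<dots> = (\<integral>\<^sup>+v. indicator ({v. v < 1/2} \<inter> A) v + ?p * indicator {v. \<not> v < 1/2} v \<partial>unif01)"
    proof (rule nn_integral_cong)
      fix v :: real
      show "emeasure S {\<omega>\<in>space S. ?first (case_nat v \<omega>) \<in> A} =
          indicator ({v. v < 1/2} \<inter> A) v + ?p * indicator {v. \<not> v < 1/2} v"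
      proof (cases "v < 1/2")
        case True
        then have "(LEAST n. case_nat v \<omega> n < 1/2) = 0" for \<omega>
          by (intro Least_eq_0) simp
        with True show ?thesis
          by (simp add: indicator_def P.emeasure_space_1)
      next
        case False
        have "emeasure S {\<omega>\<in>space S. ?first (case_nat v \<omega>) \<in> A} = ?p"
        proof (rule emeasure_eq_AE)
          show "AE \<omega> in S. \<omega> \<in> {\<omega>\<in>space S. ?first (case_nat v \<omega>) \<in> A} \<longleftrightarrow>
              \<omega> \<in> {\<omega>\<in>space S. ?first \<omega> \<in> A}"
            using ex
          proof eventually_elim
            case (elim \<omega>)
            then obtain n where "\<omega> n < 1/2" by blast
            then have "(LEAST n. case_nat v \<omega> n < 1/2) = Suc (LEAST n. \<omega> n < 1/2)"
              using False by (subst Least_Suc[of _ "Suc n"]) auto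
            then show ?case by simp
          qed
          show "{\<omega>\<in>space S. ?first (case_nat v \<omega>) \<in> A} \<in> sets S"
          proof -
            have "(\<lambda>\<omega>. case_nat v \<omega>) \<in> measurable S S" by measurable
            from measurable_compose[OF this first] show ?thesis
              by measurable
          qed
        qed measurable
        with False show ?thesis by simp
      qed
    qed
    also have "\<dots> = ?q + ?p * ennreal (1/2)"
      by (rule split[OF A])
    finally have pq: "?p = ?q + ?p * ennreal (1/2)" .
    have "?p = ?q / ennreal (1/2)"
    proof -
      define p q where "p = measure S {\<omega>\<in>space S. ?first \<omega> \<in> A}"
        and "q = measure unif01 ({v. v < 1/2} \<inter> A)"
      then have p: "?p = ennreal p" "p \<ge> 0" and q: "?q = ennreal q" "q \<ge> 0"
        by (simp_all add: P.emeasure_eq_measure U.emeasure_eq_measure)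
      have "ennreal p = ennreal (q + p * (1/2))"
        using pq unfolding p q using p(2) q(2) by (simp only: ennreal_mult ennreal_plus)
      then have "p = q / (1/2)"
        using p(2) q(2) by (subst (asm) ennreal_inj) auto
      then show ?thesis
        unfolding p q using q(2) by (subst divide_ennreal) auto
    qed
    moreover have "emeasure (distr S borel ?first) A = ?p"
      by (subst emeasure_distr[OF first A]) (simp add: vimage_def Int_def conj_commute)
    moreover have "emeasure (uniform_measure unif01 {v. v < 1/2}) A = ?q / ennreal (1/2)"
      unfolding emeasure_unif01_less_half[symmetric] by (rule emeasure_uniform_measure) auto
    ultimately show "emeasure (distr S borel ?first) A = emeasure (uniform_measure unif01 {v. v < 1/2}) A"
      by (simp only:)
  qed simp
  then have "dptext_noise Rejection b = distr (distr S borel ?first) borel (dptext_G b)"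
    by simp
  also have "\<dots> = distr S borel (\<lambda>\<omega>. dptext_G b (?first \<omega>))"
    by (subst distr_distr[OF measurable_dptext_G first]) (simp add: comp_def)
  finally show ?thesis
    by (rule sym)
qed

end

theory Submission
  imports Defs
begin

text \<open>
  The sampler only sees positive draws, so its noise is almost surely nonnegative, while every
  interval \<open>[0, t)\<close> with \<open>t > 0\<close> is hit with positive probability. For a query separating two
  neighboring datasets, say with the values \<open>0\<close> and \<open>1\<close>, the outputs below \<open>1\<close> thus have positive
  probability on the first dataset and probability \<open>0\<close> on the second; no factor \<open>exp \<epsilon>\<close> repairs this.
\<close>

lemma dptext_G_nonneg:
  assumes "b > 0" "0 < v" "v < 1/2"
  shows "dptext_G b v \<ge> 0"
  using assms by (simp add: dptext_G_def mult_le_0_iff)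

text \<open>On (0, 1/2) the transform is -b ln(1 - 2v), which is increasing. The upper bound on
  \<open>v\<close> is the solution of \<open>dptext_G b v = t\<close>.\<close>

lemma dptext_G_less:
  assumes "b > 0" "0 < v" "v < (1 - exp (- t / b)) / 2"
  shows "dptext_G b v < t"
proof -
  have "exp (- t / b) < 1 - 2 * v"
    using assms by simp
  then have "- t / b < ln (1 - 2 * v)"
    by (metis exp_gt_zero ln_exp ln_less_cancel_iff order_less_trans)
  then show ?thesis
    using assms by (simp add: dptext_G_def field_simps)
qed

lemma emeasure_unif01:
  "A \<in> sets borel \<Longrightarrow> emeasure unif01 A = emeasure lborel ({0<..<1} \<inter> A)"
  unfolding unif01_def by (simp add: emeasure_uniform_measure divide_ennreal_def)

lemma emeasure_dptext_noise_Replacement: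
  assumes "A \<in> sets borel"
  shows "emeasure (dptext_noise Replacement b) A =
    emeasure unif01 {v. (if v < 1/2 then dptext_G b v else 0) \<in> A}"
  using assms by (simp add: emeasure_distr vimage_def)

text \<open>The divisor 1/2 is the probability that a draw is accepted.\<close>

lemma emeasure_dptext_noise_Rejection:
  assumes [measurable]: "A \<in> sets borel"
  shows "emeasure (dptext_noise Rejection b) A =
    emeasure unif01 {v. v < 1/2 \<and> dptext_G b v \<in> A} / ennreal (1/2)"
proof -
  have "emeasure (dptext_noise Rejection b) A =
      emeasure (uniform_measure unif01 {v. v < 1/2}) {v. dptext_G b v \<in> A}"
    by (simp add: emeasure_distr vimage_def)
  also have "\<dots> = emeasure unif01 ({v. v < 1/2} \<inter> {v. dptext_G b v \<in> A}) / ennreal (1/2)"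
    unfolding emeasure_unif01_less_half[symmetric]
    by (rule emeasure_uniform_measure) measurable
  finally show ?thesis
    by (simp only: Collect_conj_eq)
qed

lemma measure_dptext_noise_neg:
  assumes "b > 0"
  shows "measure (dptext_noise c b) {..<0} = 0"
proof -
  \<comment> \<open>Intersecting with the support matters: on (-1/2, 0) the transform is negative.
    The replacement value 0 avoids the half-line because its end point is excluded.\<close>
  have repl: "{0<..<1} \<inter> {v. (if v < 1/2 then dptext_G b v else 0) \<in> {..<0}} = {}"
    and rej: "{0<..<1} \<inter> {v. v < 1/2 \<and> dptext_G b v \<in> {..<0}} = {}"
    using dptext_G_nonneg[OF assms] by (force split: if_splits)+
  have "emeasure (dptext_noise c b) {..<0} = 0"
  proof (cases c)
    case Replacement
    show ?thesis
      unfolding Replacement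
      by (subst emeasure_dptext_noise_Replacement, simp, subst emeasure_unif01, measurable)
        (simp only: repl emeasure_empty)
  next
    case Rejection
    show ?thesis
      unfolding Rejection
      by (subst emeasure_dptext_noise_Rejection, simp, subst emeasure_unif01, measurable)
        (simp only: rej emeasure_empty ennreal_zero_divide)
  qed
  then show ?thesis
    by (simp add: measure_def)
qed

lemma measure_dptext_noise_pos:
  assumes "b > 0" "t > 0"
  shows "measure (dptext_noise c b) {..<t} > 0"
proof -
  interpret prob_space "dptext_noise c b"
    by (rule prob_space_dptext_noise)
  \<comment> \<open>The point where the transform reaches \<open>t\<close>. As
    \<open>u < 1/2\<close>, both conventions pass the draws in (0, u) through the transform, so
    these draws, of total mass \<open>u\<close>, all give noise below \<open>t\<close>.\<close>
  define u where "u = (1 - exp (- t / b)) / 2"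
  have u: "0 < u" "u < 1/2"
    using assms by (simp_all add: u_def)
  have less: "dptext_G b v < t" if "0 < v" "v < u" for v
    using that assms by (auto intro: dptext_G_less simp: u_def)
  have "emeasure unif01 {0<..<u} = ennreal u"
  proof -
    have "{0<..<1} \<inter> {0<..<u} = {0<..<u}"
      using u by auto
    then show ?thesis
      using u by (simp add: emeasure_unif01)
  qed
  then have pos: "emeasure unif01 A > 0" if "{0<..<u} \<subseteq> A" "A \<in> sets borel" for A
    using emeasure_mono[OF that(1), of unif01] that(2) u
    by (metis ennreal_less_zero_iff order_less_le_trans sets_unif01)
  have "emeasure (dptext_noise c b) {..<t} > 0"
  proof (cases c)
    case Replacement
    have "emeasure unif01 {v. (if v < 1/2 then dptext_G b v else 0) \<in> {..<t}} > 0"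
      using u less by (intro pos) auto
    then show ?thesis
      unfolding Replacement by (subst emeasure_dptext_noise_Replacement) auto
  next
    case Rejection
    have "emeasure unif01 {v. v < 1/2 \<and> dptext_G b v \<in> {..<t}} > 0"
      using u less by (intro pos) auto
    then show ?thesis
      unfolding Rejection
      by (subst emeasure_dptext_noise_Rejection, simp)
        (simp only: ennreal_zero_less_divide ennreal_less_top)
  qed
  then show ?thesis
    by (simp add: emeasure_eq_measure)
qed

text \<open>The event constrains coordinate \<open>i\<close> only, so it reduces to the
  \<open>i\<close>-th marginal of the product measure, translated by \<open>f X i\<close>.\<close>

lemma measure_dptext_mechanism_component_less:
  assumes "i < d"
  shows "measure (dptext_mechanism c b d f X) {z \<in> space (vec_space d). z i < t} =
    measure (dptext_noise c b) {..<t - f X i}"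
proof -
  interpret product_prob_space "\<lambda>_. dptext_noise c b" "{..<d}"
    by (intro product_prob_spaceI prob_space_dptext_noise)
  let ?P = "PiM {..<d} (\<lambda>_. dptext_noise c b)"
  have i: "i \<in> {..<d}"
    using assms by simp
  have comp: "(\<lambda>s. s i) \<in> measurable ?P (dptext_noise c b)"
    using i by (rule measurable_component_singleton)
  have "(\<lambda>z. z i) \<in> borel_measurable (vec_space d)"
    using i by (rule measurable_component_singleton)
  then have S: "{z \<in> space (vec_space d). z i < t} \<in> sets (vec_space d)"
    by (rule borel_measurable_less) simp
  have shift: "(\<lambda>s. \<lambda>j\<in>{..<d}. f X j + s j) \<in> measurable ?P (vec_space d)"
    by measurable
  have "measure (dptext_mechanism c b d f X) {z \<in> space (vec_space d). z i < t} =
      measure ?P ((\<lambda>s. \<lambda>j\<in>{..<d}. f X j + s j) -` {z \<in> space (vec_space d). z i < t} \<inter> space ?P)"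
    unfolding dptext_mechanism_def by (rule measure_distr[OF shift S])
  also have "(\<lambda>s. \<lambda>j\<in>{..<d}. f X j + s j) -` {z \<in> space (vec_space d). z i < t} \<inter> space ?P =
      (\<lambda>s. s i) -` {..<t - f X i} \<inter> space ?P"
    using assms measurable_space[OF shift]
    by (intro set_eqI) (simp only: vimage_eq Int_iff mem_Collect_eq restrict_apply' i lessThan_iff
        less_diff_eq add.commute[of "f X i"], blast)
  also have "measure ?P \<dots> = measure (distr ?P (dptext_noise c b) (\<lambda>s. s i)) {..<t - f X i}"
    by (rule measure_distr[OF comp, symmetric]) simp
  also have "distr ?P (dptext_noise c b) (\<lambda>s. s i) = dptext_noise c b"
    using PiM_component[OF i] .
  finally show ?thesis .
qed

lemma l1_dist_le_l1_sensitivity: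
  assumes "finite I" "X \<subseteq> I" "X' \<subseteq> I" "neighboring X X'"
  shows "l1_dist d (f X) (f X') \<le> l1_sensitivity I d f"
  unfolding l1_sensitivity_def using assms by (intro Max_ge finite_l1_dists) auto

theorem theorem3p2:
  fixes c :: convention and \<epsilon> :: real
  assumes "\<epsilon> > 0"
  shows "\<exists>(I :: nat set) (d :: nat) (f :: nat set \<Rightarrow> nat \<Rightarrow> real).
           finite I \<and> d \<ge> 1 \<and> numeric_query I d f \<and>
           l1_sensitivity I d f > 0 \<and>
           \<not> pure_differentially_private I d \<epsilon>
               (dptext_mechanism c (l1_sensitivity I d f / \<epsilon>) d f)"
proof -
  \<comment> \<open>One individual and the counting query suffice: \<open>{}\<close> and
    \<open>I\<close> are neighboring, with counts 0 and 1.\<close>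
  define I :: "nat set" where "I = {0}"
  define f :: "nat set \<Rightarrow> nat \<Rightarrow> real" where "f X = (\<lambda>i\<in>{..<1}. real (card X))" for X
  \<comment> \<open>The threshold is the count of \<open>I\<close>: an output in \<open>S\<close>
    needs noise below 1 on \<open>{}\<close>, but negative noise on \<open>I\<close>.\<close>
  define S where "S = {z \<in> space (vec_space 1). z 0 < 1}"
  let ?b = "l1_sensitivity I 1 f / \<epsilon>"
  let ?M = "dptext_mechanism c ?b 1 f"
  have nb: "neighboring {} I"
    unfolding I_def by (rule neighboring.add) simp
  have "l1_dist 1 (f {}) (f I) = 1"
    by (simp add: l1_dist_def f_def I_def)
  \<comment> \<open>The noise bounds hold at every positive scale, so a positive lower bound on the
    sensitivity is enough.\<close>
  then have sens: "l1_sensitivity I 1 f > 0"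
    using l1_dist_le_l1_sensitivity[OF _ _ _ nb, of I 1 f] by (simp add: I_def)
  then have b: "?b > 0"
    using assms by simp
  have "measure (?M {}) S > 0"
    unfolding S_def using measure_dptext_noise_pos[OF b]
    by (simp add: measure_dptext_mechanism_component_less f_def)
  moreover have "measure (?M I) S = 0"
    unfolding S_def using measure_dptext_noise_neg[OF b]
    by (simp add: measure_dptext_mechanism_component_less f_def I_def)
  moreover have "S \<in> sets (vec_space 1)"
    unfolding S_def by measurable
  ultimately have "\<not> pure_differentially_private I 1 \<epsilon> ?M"
    unfolding pure_differentially_private_def using nb by force
  moreover have "finite I" "numeric_query I 1 f"
    by (auto simp: I_def numeric_query_def f_def)
  ultimately show ?thesis
    using sens by blast
qed

end
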